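(* There exists an absolute constant $C>0$ such that, for any integers $s,d$ satisfying $1\le s\le d$, and any $\kappa,\sigma>0$, $$\sup_{\theta\in B_2(\kappa)\cap B_0(s)} \mathbf E_\theta\big(\hat Q - Q(\theta)\big)^2 \le C\,\psi^Q_\sigma(s,d,\kappa).$$
   Context: Model: one observes $y_j=\theta_j+\sigma\xi_j$, $j=1,\dots,d$, where $\theta=(\theta_1,\dots,\theta_d)\in\mathbb R^d$ is unknown, $\xi_1,\dots,\xi_d$ are i.i.d. standard normal and $\sigma>0$. $\mathbf P_\theta$ is the law of $(y_1,\dots,y_d)$ and $\mathbf E_\theta$ the corresponding expectation. $Q(\theta)=\sum_{i=1}^d\theta_i^2$; $\|\theta\|_2=\sqrt{Q(\theta)}$; $\|\theta\|_0$ is the number of non-zero components of $\theta$; $B_0(s)=\{\theta\in\mathbb R^d:\|\theta\|_0\le s\}$; $B_2(\kappa)=\{\theta\in\mathbb R^d:\|\theta\|_2\le\kappa\}$. $$\bar\psi_\sigma(s,d)=\begin{cases}\sigma^4s^2\log^2(1+d/s^2)&\text{if } s<\sqrt d,\\ \sigma^4d&\text{if } s\ge\sqrt d,\end{cases}$$ $\psi_\sigma(s,d,\kappa)=\max\{\sigma^2\kappa^2,\bar\psi_\sigma(s,d)\}$ and $\psi^Q_\sigma(s,d,\kappa)=\min\{\kappa^4,\psi_\sigma(s,d,\kappa)\}$. With $X\sim\mathcal N(0,1)$, set $\alpha_s=\mathbf E\big(X^2\mid X^2>2\log(1+d/s^2)\big)$. The estimator is $$\hat Q=\begin{cases}\sum_{j=1}^d(y_j^2-\alpha_s\sigma^2)\,\mathbf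 1_{\{|y_j|>\sigma\sqrt{2\log(1+d/s^2)}\}}&\text{if } s<\sqrt d\text{ and }\kappa^4\ge\psi_\sigma(s,d,\kappa),\\ \sum_{j=1}^d y_j^2-d\sigma^2&\text{if } s\ge\sqrt d\text{ and }\kappa^4\ge\psi_\sigma(s,d,\kappa),\\ 0&\text{if }\kappa^4<\psi_\sigma(s,d,\kappa).\end{cases}$$ *)

theory Defs
  imports "HOL-Probability.Probability"
begin

text \<open>
  Vectors of dimension \<open>d\<close> are extensional functions on the index set \<open>{1..d}\<close>, because the
  constant in the main statement has to be uniform over all dimensions.
\<close>

definition vecs :: "nat \<Rightarrow> (nat \<Rightarrow> real) set" where
  "vecs d = PiE {1..d} (\<lambda>_. UNIV)"

definition Q :: "nat \<Rightarrow> (nat \<Rightarrow> real) \<Rightarrow> real" where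
  "Q d \<theta> = (\<Sum>i=1..d. (\<theta> i)\<^sup>2)"

definition norm2 :: "nat \<Rightarrow> (nat \<Rightarrow> real) \<Rightarrow> real" where
  "norm2 d \<theta> = sqrt (Q d \<theta>)"

definition norm0 :: "nat \<Rightarrow> (nat \<Rightarrow> real) \<Rightarrow> nat" where
  "norm0 d \<theta> = card {j \<in> {1..d}. \<theta> j \<noteq> 0}"

definition B0 :: "nat \<Rightarrow> nat \<Rightarrow> (nat \<Rightarrow> real) set" where
  "B0 d s = {\<theta> \<in> vecs d. norm0 d \<theta> \<le> s}"

definition B2 :: "nat \<Rightarrow> real \<Rightarrow> (nat \<Rightarrow> real) set" where
  "B2 d \<kappa> = {\<theta> \<in> vecs d. norm2 d \<theta> \<le> \<kappa>}"

definition std_normal :: "real measure" where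
  "std_normal = density lborel (\<lambda>x. ennreal (std_normal_density x))"

text \<open>The law of \<open>(y\<^sub>1, \<dots>, y\<^sub>d)\<close> with \<open>y\<^sub>j = \<theta>\<^sub>j + \<sigma> \<xi>\<^sub>j\<close> and the \<open>\<xi>\<^sub>j\<close> i.i.d.\ standard normal.\<close>

definition obs_law :: "nat \<Rightarrow> real \<Rightarrow> (nat \<Rightarrow> real) \<Rightarrow> (nat \<Rightarrow> real) measure" where
  "obs_law d \<sigma> \<theta> =
     distr (PiM {1..d} (\<lambda>_. std_normal)) (PiM {1..d} (\<lambda>_. borel))
       (\<lambda>\<xi>. \<lambda>j\<in>{1..d}. \<theta> j + \<sigma> * \<xi> j)"

definition psi_bar :: "real \<Rightarrow> nat \<Rightarrow> nat \<Rightarrow> real" where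
  "psi_bar \<sigma> s d =
     (if real s < sqrt (real d)
      then \<sigma> ^ 4 * (real s)\<^sup>2 * (ln (1 + real d / (real s)\<^sup>2))\<^sup>2
      else \<sigma> ^ 4 * real d)"

definition psi :: "real \<Rightarrow> nat \<Rightarrow> nat \<Rightarrow> real \<Rightarrow> real" where
  "psi \<sigma> s d \<kappa> = max (\<sigma>\<^sup>2 * \<kappa>\<^sup>2) (psi_bar \<sigma> s d)"

definition psi_Q :: "real \<Rightarrow> nat \<Rightarrow> nat \<Rightarrow> real \<Rightarrow> real" where
  "psi_Q \<sigma> s d \<kappa> = min (\<kappa> ^ 4) (psi \<sigma> s d \<kappa>)"

text \<open>
  The elementary conditional expectation \<open>E(X\<^sup>2 | A)\<close> given an event \<open>A\<close> of positive probability
  is the expectation under the conditional distribution, which \<^const>\<open>uniform_measure\<close> provides: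
  it has density \<open>1\<^sub>A / P(A)\<close> with respect to \<open>P\<close>.
\<close>

definition alpha :: "nat \<Rightarrow> nat \<Rightarrow> real" where
  "alpha s d =
     (\<integral>x. x\<^sup>2 \<partial>(uniform_measure std_normal {x. x\<^sup>2 > 2 * ln (1 + real d / (real s)\<^sup>2)}))"

definition Q_hat :: "real \<Rightarrow> nat \<Rightarrow> nat \<Rightarrow> real \<Rightarrow> (nat \<Rightarrow> real) \<Rightarrow> real" where
  "Q_hat \<sigma> s d \<kappa> y =
     (if \<kappa> ^ 4 < psi \<sigma> s d \<kappa> then 0
      else if real s < sqrt (real d)
      then (\<Sum>j=1..d. ((y j)\<^sup>2 - alpha s d * \<sigma>\<^sup>2) *
              of_bool (\<bar>y j\<bar> > \<sigma> * sqrt (2 * ln (1 + real d / (real s)\<^sup>2))))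
      else (\<Sum>j=1..d. (y j)\<^sup>2) - real d * \<sigma>\<^sup>2)"

lemma prob_space_std_normal: "prob_space std_normal"
  unfolding std_normal_def by (rule prob_space_normal_density) simp

lemma sets_std_normal [measurable_cong, simp]: "sets std_normal = sets borel"
  by (simp add: std_normal_def)

lemma prob_space_obs_law: "prob_space (obs_law d \<sigma> \<theta>)"
  unfolding obs_law_def
  by (intro prob_space.prob_space_distr prob_space_PiM prob_space_std_normal) measurable

lemma measurable_Q_hat: "Q_hat \<sigma> s d \<kappa> \<in> borel_measurable (obs_law d \<sigma> \<theta>)"
  unfolding Q_hat_def obs_law_def of_bool_def by measurable

end

theory Submission
  imports Defs "HOL-Real_Asymp.Real_Asymp"
begin

text \<open>
  The error \<open>Q_hat - Q\<close> is a sum of independent terms, one per coordinate, so its second moment is at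
  most the sum of the second moments plus the squared total bias. In the sparse regime put
  \<open>L = ln (1 + d / s\<^sup>2)\<close> and let \<open>T = sqrt (2 L) \<ge> 1\<close> be the threshold. The choice of \<open>alpha\<close> makes
  the term of a coordinate with \<open>\<theta>\<^sub>j = 0\<close> centered, and its second moment is at most
  \<open>\<sigma>\<^sup>4 E (X\<^sup>4; \<bar>X\<bar> > T)\<close>, which is of order \<open>\<sigma>\<^sup>4 T\<^sup>3 exp (- T\<^sup>2 / 2) \<le> \<sigma>\<^sup>4 T\<^sup>3 s\<^sup>2 / d\<close>.
  For each of the at most \<open>s\<close> other coordinates, thresholding changes the unbiased
  \<open>y\<^sub>j\<^sup>2 - \<sigma>\<^sup>2 - \<theta>\<^sub>j\<^sup>2\<close> by at most a constant times \<open>\<sigma>\<^sup>2 L\<close>, since \<open>alpha \<le> 2 + T\<^sup>2\<close>.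
\<close>

section \<open>Second moment of a sum of independent terms\<close>

text \<open>Expand the square: by independence an off-diagonal term integrates to the product of two
  means, while a diagonal one is a second moment.\<close>

lemma sum_square_le_product_measure:
  fixes f :: "'i \<Rightarrow> 'a \<Rightarrow> real"
  assumes M: "\<And>i. prob_space (M i)" and I: "finite I"
    and f: "\<And>i. i \<in> I \<Longrightarrow> integrable (M i) (f i)"
    and f2: "\<And>i. i \<in> I \<Longrightarrow> integrable (M i) (\<lambda>x. (f i x)\<^sup>2)"
  shows "(\<integral>\<^sup>+x. ennreal ((\<Sum>i\<in>I. f i (x i))\<^sup>2) \<partial>PiM I M)
    \<le> ennreal ((\<Sum>i\<in>I. \<integral>x. (f i x)\<^sup>2 \<partial>M i) + (\<Sum>i\<in>I. \<integral>x. f i x \<partial>M i)\<^sup>2)"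
proof -
  interpret prob_space "M i" for i by (rule M)
  interpret product_sigma_finite M by standard
  \<comment> \<open>Writes \<open>f i (x i) * f j (x j)\<close> as a product over all coordinates
    \<open>k\<close>, as Fubini for finite products requires: the factor is 1 at unrelated
    coordinates and \<open>(f i)\<^sup>2\<close> at \<open>k = i\<close> when
    \<open>i = j\<close>.\<close>
  define h where "h i j k x = (if k = i then f i x else 1) * (if k = j then f j x else 1)" for i j k x
  define m where "m i = (\<integral>x. f i x \<partial>M i)" for i
  define v where "v i = (\<integral>x. (f i x)\<^sup>2 \<partial>M i)" for i
  have h_int: "integrable (M k) (h i j k)" if "i \<in> I" "j \<in> I" "k \<in> I" for i j k
    using f[OF that(1)] f[OF that(2)] f2[OF that(1)]
    by (cases "k = i"; cases "k = j") (auto simp: h_def[abs_def] power2_eq_square)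
  have h_prod: "(\<Prod>k\<in>I. h i j k (x k)) = f i (x i) * f j (x j)" if "i \<in> I" "j \<in> I" for i j x
    using that I by (simp add: h_def prod.distrib prod.delta')
  have ij_int: "integrable (PiM I M) (\<lambda>x. f i (x i) * f j (x j))" if "i \<in> I" "j \<in> I" for i j
    using product_integrable_prod[OF I h_int[OF that]] by (simp add: h_prod that)
  have ij: "(\<integral>x. f i (x i) * f j (x j) \<partial>PiM I M) = (if i = j then v i else m i * m j)"
    if "i \<in> I" "j \<in> I" for i j
  proof -
    have "(\<integral>x. f i (x i) * f j (x j) \<partial>PiM I M) = (\<Prod>k\<in>I. integral\<^sup>L (M k) (h i j k))"
      using product_integral_prod[OF I h_int[OF that]] by (simp add: h_prod that)
    also have "\<dots> = (\<Prod>k\<in>I. if i = j then (if k = i then v i else 1)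
        else (if k = i then m i else 1) * (if k = j then m j else 1))"
      by (intro prod.cong) (auto simp: h_def[abs_def] m_def v_def power2_eq_square prob_space)
    also have "\<dots> = (if i = j then v i else m i * m j)"
      using that I by (auto simp: prod.distrib prod.delta')
    finally show ?thesis .
  qed
  have sq: "(\<Sum>i\<in>I. f i (x i))\<^sup>2 = (\<Sum>i\<in>I. \<Sum>j\<in>I. f i (x i) * f j (x j))" for x
    by (simp add: power2_eq_square sum_product)
  have "(\<integral>x. (\<Sum>i\<in>I. f i (x i))\<^sup>2 \<partial>PiM I M) = (\<Sum>i\<in>I. \<Sum>j\<in>I. if i = j then v i else m i * m j)"
    unfolding sq by (simp add: ij_int ij)
  \<comment> \<open>Adding the nonnegative \<open>m i * m i\<close> on the diagonal completes the
    double sum to the square of the total mean.\<close>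
  also have "\<dots> \<le> (\<Sum>i\<in>I. \<Sum>j\<in>I. (if i = j then v i else 0) + m i * m j)"
    by (intro sum_mono) auto
  also have "\<dots> = (\<Sum>i\<in>I. v i) + (\<Sum>i\<in>I. m i)\<^sup>2"
    using I by (simp add: sum.distrib sum_product power2_eq_square)
  finally have "(\<integral>x. (\<Sum>i\<in>I. f i (x i))\<^sup>2 \<partial>PiM I M) \<le> (\<Sum>i\<in>I. v i) + (\<Sum>i\<in>I. m i)\<^sup>2" .
  moreover have "integrable (PiM I M) (\<lambda>x. (\<Sum>i\<in>I. f i (x i))\<^sup>2)"
    unfolding sq by (intro Bochner_Integration.integrable_sum ij_int)
  ultimately show ?thesis
    by (simp add: nn_integral_eq_integral m_def v_def ennreal_leI)
qed

section \<open>Moments of the standard normal law\<close>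

lemma integrable_std_normal_iff:
  fixes f :: "real \<Rightarrow> real"
  shows "f \<in> borel_measurable borel \<Longrightarrow>
    integrable std_normal f \<longleftrightarrow> integrable lborel (\<lambda>x. std_normal_density x * f x)"
  unfolding std_normal_def by (subst integrable_density) auto

lemma integral_std_normal:
  fixes f :: "real \<Rightarrow> real"
  shows "f \<in> borel_measurable borel \<Longrightarrow>
    (\<integral>x. f x \<partial>std_normal) = (\<integral>x. std_normal_density x * f x \<partial>lborel)"
  unfolding std_normal_def by (subst integral_density) auto

lemma integrable_std_normal_power [simp]: "integrable std_normal (\<lambda>x. x ^ k)"
  by (subst integrable_std_normal_iff) (auto intro: integrable_std_normal_moment)

lemma integral_std_normal_power:
  "(\<integral>x. x \<partial>std_normal) = 0" "(\<integral>x. x\<^sup>2 \<partial>std_normal) = 1"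
  "(\<integral>x. x ^ 3 \<partial>std_normal) = 0" "(\<integral>x. x ^ 4 \<partial>std_normal) = 3"
  using integral_std_normal_moment_odd[of 0] integral_std_normal_moment_even[of 1]
    integral_std_normal_moment_odd[of 1] integral_std_normal_moment_even[of 2]
  by (simp_all add: integral_std_normal fact_numeral power_Suc numeral_3_eq_3[symmetric])

section \<open>Truncated Gaussian moments\<close>

text \<open>\<open>- F\<close> is a primitive of the density times \<open>f\<close> that vanishes at
  infinity, so this is the fundamental theorem of calculus on a half-line. Each tail below then only
  needs a suitable \<open>F\<close>.\<close>

lemma std_normal_tail:
  fixes a :: real and f F :: "real \<Rightarrow> real"
  assumes [measurable]: "f \<in> borel_measurable borel"
    and deriv: "\<And>x. a \<le> x \<Longrightarrow> (F has_real_derivative - (std_normal_density x * f x)) (at x)"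
    and nonneg: "\<And>x. a \<le> x \<Longrightarrow> 0 \<le> f x"
    and lim: "(F \<longlongrightarrow> 0) at_top"
  shows "has_bochner_integral std_normal (\<lambda>x. f x * indicator {a<..} x) (F a)"
proof -
  have d: "((\<lambda>x. - F x) has_real_derivative std_normal_density x * f x) (at x)" if "a \<le> x" for x
    using DERIV_minus[OF deriv[OF that]] by simp
  have l: "((\<lambda>x. - F x) \<longlongrightarrow> 0) at_top"
    using tendsto_minus[OF lim] by simp
  \<comment> \<open>\<open>F\<close> decreases to its limit 0 on the half-line. The sign is needed
    to return from \<open>ennreal\<close> to a real integral.\<close>
  have F0: "0 \<le> F a"
  proof (rule tendsto_upperbound[OF lim])
    show "\<forall>\<^sub>F x in at_top. F x \<le> F a"
      using eventually_ge_at_top[of a]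
    proof eventually_elim
      case (elim x)
      show ?case
        by (rule DERIV_nonpos_imp_nonincreasing[OF elim])
          (use deriv nonneg in \<open>force intro: mult_nonneg_nonneg\<close>)
    qed
  qed simp
  have "(\<integral>\<^sup>+x. ennreal (f x * indicator {a<..} x) \<partial>std_normal)
      = (\<integral>\<^sup>+x. ennreal (std_normal_density x) * ennreal (f x * indicator {a<..} x) \<partial>lborel)"
    unfolding std_normal_def by (subst nn_integral_density) auto
  also have "\<dots> = (\<integral>\<^sup>+x. ennreal (std_normal_density x * f x) * indicator {a..} x \<partial>lborel)"
  \<comment> \<open>The open and the closed half-line differ by the null set
    \<open>{a}\<close>.\<close>
  proof (intro nn_integral_cong_AE)
    show "AE x in lborel. ennreal (std_normal_density x) * ennreal (f x * indicator {a<..} x)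
        = ennreal (std_normal_density x * f x) * indicator {a..} x"
      using AE_lborel_singleton[of a]
      by eventually_elim (auto simp: ennreal_mult' indicator_def nonneg)
  qed
  also have "\<dots> = ennreal (0 - - F a)"
    by (rule nn_integral_FTC_atLeast[OF _ d _ l]) (auto simp: nonneg)
  finally show ?thesis
    using F0 nonneg by (intro has_bochner_integral_nn_integral) (auto simp: indicator_def)
qed

lemma distr_std_normal_uminus: "distr std_normal borel uminus = std_normal"
proof -
  have "density (distr lborel borel uminus) (\<lambda>x. ennreal (std_normal_density x))
      = distr (density lborel (\<lambda>x. ennreal (std_normal_density (- x)))) borel uminus"
    by (rule density_distr) auto
  then show ?thesis
    by (simp add: std_normal_def lborel_distr_uminus std_normal_density_def)
qed

text \<open>Reflection carries the right tail to the left one, where the even function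
  \<open>f\<close> has the same integral; \<open>0 \<le> a\<close> makes the two tails
  disjoint.\<close>

lemma std_normal_two_sided_tail:
  fixes a v :: real and f :: "real \<Rightarrow> real"
  assumes [measurable]: "f \<in> borel_measurable borel"
    and f: "has_bochner_integral std_normal (\<lambda>x. f x * indicator {a<..} x) v"
    and "0 \<le> a" "\<And>x. f (- x) = f x"
  shows "has_bochner_integral std_normal (\<lambda>x. f x * indicator {x. a < \<bar>x\<bar>} x) (2 * v)"
proof -
  have "has_bochner_integral (distr std_normal borel uminus) (\<lambda>x. f x * indicator {a<..} x) v"
    using f by (simp add: distr_std_normal_uminus)
  then have "has_bochner_integral std_normal (\<lambda>x. f (- x) * indicator {a<..} (- x)) v"
    by (auto simp: has_bochner_integral_iff integrable_distr_eq integral_distr)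
  from has_bochner_integral_add[OF f this]
  have "has_bochner_integral std_normal
      (\<lambda>x. f x * indicator {a<..} x + f (- x) * indicator {a<..} (- x)) (2 * v)" by simp
  also have "(\<lambda>x. f x * indicator {a<..} x + f (- x) * indicator {a<..} (- x))
      = (\<lambda>x. f x * indicator {x. a < \<bar>x\<bar>} x)"
    using assms(3,4) by (auto simp: indicator_def fun_eq_iff)
  finally show ?thesis .
qed

lemma std_normal_density_deriv:
  "(std_normal_density has_real_derivative - (x * std_normal_density x)) (at x within S)"
  unfolding std_normal_density_def [abs_def]
  by (auto intro!: derivative_eq_intros simp: field_simps power2_eq_square)

lemma std_normal_tail_1:
  "0 \<le> a \<Longrightarrow> has_bochner_integral std_normal (\<lambda>x. x * indicator {a<..} x) (std_normal_density a)"
proof (rule std_normal_tail)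
  show "(std_normal_density \<longlongrightarrow> 0) at_top"
    unfolding std_normal_density_def [abs_def] by real_asymp
qed (auto intro!: std_normal_density_deriv[THEN DERIV_cong])

text \<open>The derivative of \<open>x * std_normal_density x\<close> is
  \<open>- (x\<^sup>2 - 1) * std_normal_density x\<close>; from \<open>1 \<le> a\<close> on the
  integrand is nonnegative.\<close>

lemma std_normal_tail_2:
  "1 \<le> a \<Longrightarrow> has_bochner_integral std_normal (\<lambda>x. (x\<^sup>2 - 1) * indicator {a<..} x)
    (a * std_normal_density a)"
proof (rule std_normal_tail)
  show "((\<lambda>x. x * std_normal_density x) \<longlongrightarrow> 0) at_top"
    unfolding std_normal_density_def [abs_def] by real_asymp
  show "0 \<le> x\<^sup>2 - 1" if "1 \<le> a" "a \<le> x" for x :: real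
    using that by simp
qed (auto intro!: derivative_eq_intros std_normal_density_deriv simp: algebra_simps power2_eq_square)

text \<open>The summand \<open>3 / x\<^sup>2\<close> makes the primitive elementary.\<close>

lemma std_normal_tail_4:
  "1 \<le> a \<Longrightarrow> has_bochner_integral std_normal (\<lambda>x. (x ^ 4 + 3 / x\<^sup>2) * indicator {a<..} x)
    ((a ^ 3 + 3 * a + 3 / a) * std_normal_density a)"
proof (rule std_normal_tail)
  show "((\<lambda>x. (x ^ 3 + 3 * x + 3 / x) * std_normal_density x) \<longlongrightarrow> 0) at_top"
    unfolding std_normal_density_def [abs_def] by real_asymp
qed (auto intro!: derivative_eq_intros std_normal_density_deriv
    simp: field_simps power2_eq_square power3_eq_cube power4_eq_xxxx)


lemma std_normal_tail_fourth_moment: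
  fixes a :: real
  assumes "1 \<le> a"
  shows "integrable std_normal (\<lambda>x. x ^ 4 * indicator {x. a < \<bar>x\<bar>} x)"
    and "(\<integral>x. x ^ 4 * indicator {x. a < \<bar>x\<bar>} x \<partial>std_normal) \<le> 14 * a ^ 3 * std_normal_density a"
proof -
  let ?A = "{x. a < \<bar>x\<bar>}"
  show int: "integrable std_normal (\<lambda>x. x ^ 4 * indicator ?A x)"
    by (rule integrable_real_mult_indicator) auto
  have *: "has_bochner_integral std_normal (\<lambda>x. (x ^ 4 + 3 / x\<^sup>2) * indicator ?A x)
      (2 * ((a ^ 3 + 3 * a + 3 / a) * std_normal_density a))"
    by (rule std_normal_two_sided_tail[OF _ std_normal_tail_4]) (use assms in auto)
  have "(\<integral>x. x ^ 4 * indicator ?A x \<partial>std_normal)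
      \<le> (\<integral>x. (x ^ 4 + 3 / x\<^sup>2) * indicator ?A x \<partial>std_normal)"
    using * by (intro integral_mono int) (auto simp: has_bochner_integral_iff indicator_def)
  also have "\<dots> = 2 * (a ^ 3 + 3 * a + 3 / a) * std_normal_density a"
    using * by (simp add: has_bochner_integral_iff)
  \<comment> \<open>For \<open>a \<ge> 1\<close>, both \<open>a\<close> and \<open>1 / a\<close> are
    at most \<open>a ^ 3\<close>, and \<open>14 = 2 * (1 + 3 + 3)\<close>.\<close>
  also have "\<dots> \<le> 14 * a ^ 3 * std_normal_density a"
  proof (rule mult_right_mono)
    have "a ^ 1 \<le> a ^ 3" using assms by (intro power_increasing) auto
    moreover have "3 / a \<le> 3" using assms by (simp add: field_simps)
    ultimately show "2 * (a ^ 3 + 3 * a + 3 / a) \<le> 14 * a ^ 3" using assms by simp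
  qed simp
  finally show "(\<integral>x. x ^ 4 * indicator ?A x \<partial>std_normal) \<le> 14 * a ^ 3 * std_normal_density a" .
qed

text \<open>
  Combining the two elementary tails \<open>E (\<bar>X\<bar>; A)\<close> and \<open>E (X\<^sup>2 - 1; A)\<close> gives
  \<open>E (X\<^sup>2 - a \<bar>X\<bar>; A) = P A\<close>; on the other hand \<open>x\<^sup>2 \<le> a\<^sup>2 + 2 (x\<^sup>2 - a \<bar>x\<bar>)\<close>.
\<close>

lemma std_normal_tail_second_moment:
  fixes a :: real
  assumes "1 \<le> a"
  defines "A \<equiv> {x. a < \<bar>x\<bar>}"
  shows "(\<integral>x. x\<^sup>2 * indicator A x \<partial>std_normal) \<le> (2 + a\<^sup>2) * measure std_normal A"
    and "0 < measure std_normal A"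
proof -
  interpret prob_space std_normal by (rule prob_space_std_normal)
  have A [measurable]: "A \<in> sets borel" by (simp add: A_def)
  define m where "m = (\<integral>x. x\<^sup>2 * indicator A x \<partial>std_normal)"
  have int: "integrable std_normal (\<lambda>x. x\<^sup>2 * indicator A x)"
    by (rule integrable_real_mult_indicator) (auto simp: A)
  have int1: "integrable std_normal (indicator A :: real \<Rightarrow> real)"
    by (rule integrable_real_indicator) (auto simp: A emeasure_eq_measure)
  have P: "(\<integral>x. indicator A x \<partial>std_normal) = measure std_normal A"
    by simp
  have 1: "has_bochner_integral std_normal (\<lambda>x. \<bar>x\<bar> * indicator A x) (2 * std_normal_density a)"
    unfolding A_def
  proof (rule std_normal_two_sided_tail)
    have "(\<lambda>x. x * indicator {a<..} x) = (\<lambda>x. \<bar>x\<bar> * indicator {a<..} x)"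
      using assms by (auto simp: indicator_def)
    then show "has_bochner_integral std_normal (\<lambda>x. \<bar>x\<bar> * indicator {a<..} x) (std_normal_density a)"
      using std_normal_tail_1[of a] assms by simp
  qed (use assms in auto)
  have "has_bochner_integral std_normal (\<lambda>x. (x\<^sup>2 - 1) * indicator A x) (2 * (a * std_normal_density a))"
    unfolding A_def
    by (rule std_normal_two_sided_tail[OF _ std_normal_tail_2]) (use assms in auto)
  then have 2: "2 * (a * std_normal_density a) = m - measure std_normal A"
    using int int1 P by (simp add: has_bochner_integral_iff m_def left_diff_distrib)
  have "m - a\<^sup>2 * measure std_normal A = (\<integral>x. x\<^sup>2 * indicator A x - a\<^sup>2 * indicator A x \<partial>std_normal)"
    using int int1 P by (simp add: m_def)
  also have "\<dots> \<le> (\<integral>x. 2 * (x\<^sup>2 * indicator A x) - 2 * a * (\<bar>x\<bar> * indicator A x) \<partial>std_normal)"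
  proof (rule integral_mono)
    fix x
    have "0 \<le> (\<bar>x\<bar> - a)\<^sup>2" by simp
    then show "x\<^sup>2 * indicator A x - a\<^sup>2 * indicator A x
        \<le> 2 * (x\<^sup>2 * indicator A x) - 2 * a * (\<bar>x\<bar> * indicator A x)"
      by (auto simp: indicator_def power2_eq_square algebra_simps)
  qed (use int int1 1 in \<open>auto simp: has_bochner_integral_iff\<close>)
  also have "\<dots> = 2 * m - 2 * a * (2 * std_normal_density a)"
    using int 1 by (simp add: has_bochner_integral_iff m_def)
  finally have le: "m \<le> (2 + a\<^sup>2) * measure std_normal A"
    using 2 by (simp add: algebra_simps)
  then show "(\<integral>x. x\<^sup>2 * indicator A x \<partial>std_normal) \<le> (2 + a\<^sup>2) * measure std_normal A"
    by (simp add: m_def)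
  \<comment> \<open>This quantity is \<open>m - P A\<close>, and
    \<open>m \<le> (2 + a\<^sup>2) * P A\<close>; hence \<open>(1 + a\<^sup>2) * P A\<close> is
    positive.\<close>
  have "0 < 2 * (a * std_normal_density a)" using assms by (simp add: normal_density_pos)
  with 2 le have "0 < (1 + a\<^sup>2) * measure std_normal A"
    by (simp add: algebra_simps)
  then show "0 < measure std_normal A"
    by (simp add: zero_less_mult_iff add_pos_nonneg)
qed

section \<open>The threshold and the centering constant\<close>

lemma (in prob_space) integral_uniform_measure:
  fixes f :: "'a \<Rightarrow> real"
  assumes [measurable]: "A \<in> sets M" "f \<in> borel_measurable M" and "measure M A > 0"
  shows "(\<integral>x. f x \<partial>uniform_measure M A) = (\<integral>x. f x * indicator A x \<partial>M) / measure M A"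
proof -
  have "uniform_measure M A = density M (\<lambda>x. ennreal (indicator A x / measure M A))"
    unfolding uniform_measure_def emeasure_eq_measure
    using assms(3) by (intro density_cong) (auto simp: indicator_def divide_ennreal simp flip: ennreal_1)
  then show ?thesis
    by (simp add: integral_density mult.commute)
qed

text \<open>The cutoff in units of the noise level, so that
  \<open>exp (- T\<^sup>2 / 2) = 1 / (1 + d / s\<^sup>2)\<close> for
  \<open>T = threshold s d\<close>.\<close>

definition threshold :: "nat \<Rightarrow> nat \<Rightarrow> real" where
  "threshold s d = sqrt (2 * ln (1 + real d / (real s)\<^sup>2))"

text \<open>Since \<open>s\<^sup>2 < d\<close>, the logarithm is at least
  \<open>ln 2 \<ge> 2 / 3\<close>, so the squared threshold is at least \<open>4 / 3\<close>. This
  makes the tail bounds applicable and lets constants be absorbed into powers of the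
  threshold.\<close>

lemma threshold_ge_1:
  assumes "1 \<le> s" "real s < sqrt (real d)"
  shows "1 \<le> threshold s d"
proof -
  have "(real s)\<^sup>2 < real d"
    using power_strict_mono[OF assms(2), of 2] by simp
  then have "2 \<le> 1 + real d / (real s)\<^sup>2"
    using assms(1) by (simp add: field_simps)
  then have "ln 2 \<le> ln (1 + real d / (real s)\<^sup>2)" by simp
  then show ?thesis using ln2_ge_two_thirds by (simp add: threshold_def)
qed

text \<open>\<open>alpha\<close> is the ratio of \<open>E (X\<^sup>2; A)\<close> to
  \<open>P A\<close>, which gives its upper bound and the centering at once. The last bound balances
  the \<open>d\<close> null coordinates against the Gaussian tail at the threshold.\<close>

lemma alpha_moments:
  assumes "1 \<le> s" "real s < sqrt (real d)"
  defines "A \<equiv> {x. threshold s d < \<bar>x\<bar>}"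
  shows "0 \<le> alpha s d" "alpha s d \<le> 2 + (threshold s d)\<^sup>2"
    and "(\<integral>x. (x\<^sup>2 - alpha s d) * indicator A x \<partial>std_normal) = 0"
    and "real d * (\<integral>x. ((x\<^sup>2 - alpha s d) * indicator A x)\<^sup>2 \<partial>std_normal)
      \<le> 14 * (real s)\<^sup>2 * threshold s d ^ 4"
proof -
  interpret prob_space std_normal by (rule prob_space_std_normal)
  define a where "a = threshold s d"
  have a: "1 \<le> a" using threshold_ge_1 assms by (simp add: a_def)
  have A [measurable]: "A \<in> sets borel" by (simp add: A_def)
  note tail = std_normal_tail_second_moment[OF a, folded a_def A_def]
  have A_eq: "{x. x\<^sup>2 > 2 * ln (1 + real d / (real s)\<^sup>2)} = A"
    by (auto simp: A_def threshold_def real_sqrt_less_iff simp flip: real_sqrt_abs)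
  let ?P = "measure std_normal A" and ?m = "\<integral>x. x\<^sup>2 * indicator A x \<partial>std_normal"
  have \<alpha>: "alpha s d = ?m / ?P"
    unfolding alpha_def A_eq by (rule integral_uniform_measure) (use tail A_def a_def in auto)
  have int: "integrable std_normal (\<lambda>x. x ^ k * indicator A x)" for k
    by (rule integrable_real_mult_indicator) (auto simp: A)
  have int1: "integrable std_normal (indicator A :: real \<Rightarrow> real)"
    by (rule integrable_real_indicator) (auto simp: A emeasure_eq_measure)
  have P: "0 < ?P" "?m \<le> (2 + a\<^sup>2) * ?P"
    using tail by (auto simp: A_def a_def)
  show "0 \<le> alpha s d" unfolding \<alpha> by simp
  show "alpha s d \<le> 2 + (threshold s d)\<^sup>2"
    unfolding \<alpha> using P by (simp add: a_def field_simps)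
  have m: "?m = alpha s d * ?P" using P by (simp add: \<alpha>)
  show "(\<integral>x. (x\<^sup>2 - alpha s d) * indicator A x \<partial>std_normal) = 0"
    using int[of 2] int1 m by (simp add: left_diff_distrib)
  have "(\<integral>x. ((x\<^sup>2 - alpha s d) * indicator A x)\<^sup>2 \<partial>std_normal)
      = (\<integral>x. x ^ 4 * indicator A x - 2 * alpha s d * (x\<^sup>2 * indicator A x)
          + (alpha s d)\<^sup>2 * indicator A x \<partial>std_normal)"
    by (intro Bochner_Integration.integral_cong)
      (auto simp: indicator_def power2_eq_square power4_eq_xxxx algebra_simps)
  \<comment> \<open>The cross term is \<open>- 2 * (alpha s d)\<^sup>2 * P A\<close> because
    \<open>E (X\<^sup>2; A) = alpha s d * P A\<close>.\<close>
  also have "\<dots> = (\<integral>x. x ^ 4 * indicator A x \<partial>std_normal) - (alpha s d)\<^sup>2 * ?P"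
    using int[of 2] int[of 4] int1 m by (simp add: power2_eq_square)
  also have "\<dots> \<le> 14 * a ^ 3 * std_normal_density a"
  proof -
    have "0 \<le> (alpha s d)\<^sup>2 * ?P" by simp
    then show ?thesis
      using std_normal_tail_fourth_moment(2)[OF a] by (simp only: A_def a_def)
  qed
  \<comment> \<open>The power is rounded up because \<open>a ^ 4\<close> is four times the squared
    logarithm in \<open>psi_bar\<close>.\<close>
  also have "\<dots> \<le> 14 * a ^ 4 * std_normal_density a"
    using a by (intro mult_right_mono mult_left_mono power_increasing) auto
  finally have "real d * (\<integral>x. ((x\<^sup>2 - alpha s d) * indicator A x)\<^sup>2 \<partial>std_normal)
      \<le> real d * (14 * a ^ 4 * std_normal_density a)"
    by (rule mult_left_mono) simp
  \<comment> \<open>The threshold is chosen for this: the density at \<open>a\<close> is at most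
    \<open>1 / (1 + d / s\<^sup>2)\<close>, hence at most \<open>s\<^sup>2 / d\<close> when
    \<open>d > 0\<close>.\<close>
  also have "real d * std_normal_density a \<le> (real s)\<^sup>2"
  proof -
    have pos: "0 < 1 + real d / (real s)\<^sup>2" by (simp add: add_pos_nonneg)
    have "a\<^sup>2 = 2 * ln (1 + real d / (real s)\<^sup>2)"
      by (simp add: a_def threshold_def)
    then have "std_normal_density a = 1 / sqrt (2 * pi) * (1 / (1 + real d / (real s)\<^sup>2))"
      using pos by (simp add: std_normal_density_def exp_minus inverse_eq_divide)
    also have "\<dots> \<le> 1 * (1 / (1 + real d / (real s)\<^sup>2))"
      using pi_ge_two by (intro mult_right_mono) auto
    finally have "real d * std_normal_density a \<le> real d * (1 / (1 + real d / (real s)\<^sup>2))"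
      by (intro mult_left_mono) simp_all
    also have "\<dots> \<le> (real s)\<^sup>2"
      using assms(1) pos by (simp add: field_simps)
    finally show ?thesis .
  qed
  then have "real d * (14 * a ^ 4 * std_normal_density a) \<le> 14 * (real s)\<^sup>2 * a ^ 4"
    using mult_left_mono[of "real d * std_normal_density a" "(real s)\<^sup>2" "14 * a ^ 4"]
    by (simp add: ac_simps)
  finally show "real d * (\<integral>x. ((x\<^sup>2 - alpha s d) * indicator A x)\<^sup>2 \<partial>std_normal)
      \<le> 14 * (real s)\<^sup>2 * threshold s d ^ 4"
    by (simp add: a_def)
qed

section \<open>Error of a single coordinate\<close>

text \<open>With \<open>y = t + \<sigma> * x\<close>, the function \<open>g\<close> is the unbiased
  error \<open>y\<^sup>2 - \<sigma>\<^sup>2 - t\<^sup>2\<close>; its moments follow from the first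
  four Gaussian ones.\<close>

lemma centered_square_moments:
  fixes t \<sigma> :: real
  defines "g \<equiv> \<lambda>x. 2 * t * \<sigma> * x + \<sigma>\<^sup>2 * (x\<^sup>2 - 1)"
  shows "integrable std_normal g" "integrable std_normal (\<lambda>x. (g x)\<^sup>2)"
    "(\<integral>x. g x \<partial>std_normal) = 0"
    "(\<integral>x. (g x)\<^sup>2 \<partial>std_normal) = 4 * t\<^sup>2 * \<sigma>\<^sup>2 + 2 * \<sigma> ^ 4"
proof -
  interpret prob_space std_normal by (rule prob_space_std_normal)
  have int: "integrable std_normal (\<lambda>x. x)"
    using integrable_std_normal_power[of 1] by simp
  show "integrable std_normal g" "(\<integral>x. g x \<partial>std_normal) = 0"
    using int by (simp_all add: g_def integral_std_normal_power prob_space)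
  have g2: "(\<lambda>x. (g x)\<^sup>2) = (\<lambda>x. \<sigma> ^ 4 * x ^ 4 + 4 * t * \<sigma> ^ 3 * x ^ 3
      + (4 * t\<^sup>2 * \<sigma>\<^sup>2 - 2 * \<sigma> ^ 4) * x\<^sup>2 - 4 * t * \<sigma> ^ 3 * x + \<sigma> ^ 4)"
    unfolding g_def by (rule ext) algebra
  show "integrable std_normal (\<lambda>x. (g x)\<^sup>2)"
    "(\<integral>x. (g x)\<^sup>2 \<partial>std_normal) = 4 * t\<^sup>2 * \<sigma>\<^sup>2 + 2 * \<sigma> ^ 4"
    unfolding g2 using int by (simp_all add: integral_std_normal_power prob_space)
qed

text \<open>The mean of the sum comes from \<open>B\<close> alone, and
  \<open>(g + B)\<^sup>2 \<le> 2 * g\<^sup>2 + 2 * B\<^sup>2\<close> because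
  \<open>(g - B)\<^sup>2 \<ge> 0\<close>.\<close>

lemma bounded_perturbation_moments:
  fixes g B :: "real \<Rightarrow> real"
  assumes "prob_space M" and g: "integrable M g" "integrable M (\<lambda>x. (g x)\<^sup>2)" "(\<integral>x. g x \<partial>M) = 0"
    and [measurable]: "B \<in> borel_measurable M" and B: "\<And>x. \<bar>B x\<bar> \<le> b"
  shows "integrable M (\<lambda>x. g x + B x)" "integrable M (\<lambda>x. (g x + B x)\<^sup>2)"
    "\<bar>\<integral>x. g x + B x \<partial>M\<bar> \<le> b"
    "(\<integral>x. (g x + B x)\<^sup>2 \<partial>M) \<le> 2 * (\<integral>x. (g x)\<^sup>2 \<partial>M) + 2 * b\<^sup>2"
proof -
  interpret prob_space M by fact
  have [measurable]: "g \<in> borel_measurable M" using g by auto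
  have B_int: "integrable M B"
    using B by (intro integrable_const_bound[of _ b]) auto
  have b0: "0 \<le> b" using B[of undefined] by simp
  have B2: "(B x)\<^sup>2 \<le> b\<^sup>2" for x
    using B[of x] b0 by (metis abs_le_square_iff abs_of_nonneg)
  show "integrable M (\<lambda>x. g x + B x)" using g B_int by simp
  have le: "(g x + B x)\<^sup>2 \<le> 2 * (g x)\<^sup>2 + 2 * b\<^sup>2" for x
    using B2[of x] sum_squares_ge_zero[of "g x - B x" 0]
    by (simp add: power2_eq_square algebra_simps)
  show int2: "integrable M (\<lambda>x. (g x + B x)\<^sup>2)"
    by (rule Bochner_Integration.integrable_bound[of _ "\<lambda>x. 2 * (g x)\<^sup>2 + 2 * b\<^sup>2"])
      (use g le in \<open>auto simp: order_trans[OF le]\<close>)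
  have "(\<integral>x. (g x + B x)\<^sup>2 \<partial>M) \<le> (\<integral>x. 2 * (g x)\<^sup>2 + 2 * b\<^sup>2 \<partial>M)"
    using g le int2 by (intro integral_mono) auto
  then show "(\<integral>x. (g x + B x)\<^sup>2 \<partial>M) \<le> 2 * (\<integral>x. (g x)\<^sup>2 \<partial>M) + 2 * b\<^sup>2"
    using g by (simp add: prob_space)
  have "\<bar>\<integral>x. B x \<partial>M\<bar> \<le> (\<integral>x. \<bar>B x\<bar> \<partial>M)"
    by (rule integral_abs_bound)
  also have "\<dots> \<le> (\<integral>x. b \<partial>M)"
    using B B_int by (intro integral_mono) auto
  finally show "\<bar>\<integral>x. g x + B x \<partial>M\<bar> \<le> b"
    using g B_int by (simp add: prob_space)
qed

text \<open>One coordinate's share of \<open>Q_hat - Q\<close> in the sparse regime, as a function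
  of the standardized noise \<open>x\<close>, with \<open>t\<close> the true value.\<close>

definition thresholded_error :: "real \<Rightarrow> nat \<Rightarrow> nat \<Rightarrow> real \<Rightarrow> real \<Rightarrow> real" where
  "thresholded_error \<sigma> s d t x = ((t + \<sigma> * x)\<^sup>2 - alpha s d * \<sigma>\<^sup>2) *
     of_bool (\<bar>t + \<sigma> * x\<bar> > \<sigma> * threshold s d) - t\<^sup>2"

lemma thresholded_error_moments:
  fixes t \<sigma> :: real
  assumes sd: "1 \<le> s" "real s < sqrt (real d)" and \<sigma>: "0 < \<sigma>"
  defines "b \<equiv> 7 * \<sigma>\<^sup>2 * (threshold s d)\<^sup>2"
  shows "integrable std_normal (thresholded_error \<sigma> s d t)"
    "integrable std_normal (\<lambda>x. (thresholded_error \<sigma> s d t x)\<^sup>2)"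
    "\<bar>\<integral>x. thresholded_error \<sigma> s d t x \<partial>std_normal\<bar> \<le> b"
    "(\<integral>x. (thresholded_error \<sigma> s d t x)\<^sup>2 \<partial>std_normal) \<le> 8 * t\<^sup>2 * \<sigma>\<^sup>2 + 4 * \<sigma> ^ 4 + 2 * b\<^sup>2"
proof -
  define T \<alpha> where "T = threshold s d" and "\<alpha> = alpha s d"
  define g where "g x = 2 * t * \<sigma> * x + \<sigma>\<^sup>2 * (x\<^sup>2 - 1)" for x
  \<comment> \<open>What thresholding and the replacement of 1 by \<alpha> add to the unbiased error
    \<open>g\<close>: a constant, minus the summand lost below the cutoff, where the observation is
    bounded.\<close>
  define B where "B x = (1 - \<alpha>) * \<sigma>\<^sup>2
      - ((t + \<sigma> * x)\<^sup>2 - \<alpha> * \<sigma>\<^sup>2) * indicator {x. \<bar>t + \<sigma> * x\<bar> \<le> \<sigma> * T} x" for x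
  have T: "1 \<le> T" using threshold_ge_1[OF sd] by (simp add: T_def)
  have \<alpha>: "0 \<le> \<alpha>" "\<alpha> \<le> 2 + T\<^sup>2" using alpha_moments[OF sd] by (simp_all add: T_def \<alpha>_def)
  have eq: "thresholded_error \<sigma> s d t x = g x + B x" for x
    by (auto simp: thresholded_error_def g_def B_def T_def \<alpha>_def power2_eq_square algebra_simps
        indicator_def)
  have B_meas: "B \<in> borel_measurable std_normal"
    unfolding B_def[abs_def] by measurable
  have B_le: "\<bar>B x\<bar> \<le> b" for x
  proof -
    define w where "w = ((t + \<sigma> * x)\<^sup>2 - \<alpha> * \<sigma>\<^sup>2) * indicator {x. \<bar>t + \<sigma> * x\<bar> \<le> \<sigma> * T} x"
    \<comment> \<open>Below the cutoff \<open>w\<close> is a difference of two numbers in the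
      interval from 0 to \<open>(2 + T\<^sup>2) * \<sigma>\<^sup>2\<close>; above it,
      \<open>w\<close> vanishes.\<close>
    have "\<bar>w\<bar> \<le> (2 + T\<^sup>2) * \<sigma>\<^sup>2"
    proof (cases "\<bar>t + \<sigma> * x\<bar> \<le> \<sigma> * T")
      case True
      then have "(t + \<sigma> * x)\<^sup>2 \<le> (\<sigma> * T)\<^sup>2"
        by (metis abs_ge_zero power2_abs power_mono)
      moreover have "\<alpha> * \<sigma>\<^sup>2 \<le> (2 + T\<^sup>2) * \<sigma>\<^sup>2" "0 \<le> \<alpha> * \<sigma>\<^sup>2"
        using \<alpha> by (auto intro: mult_right_mono)
      moreover have "0 \<le> (t + \<sigma> * x)\<^sup>2" "0 \<le> \<sigma>\<^sup>2" by simp_all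
      moreover have "(\<sigma> * T)\<^sup>2 \<le> (2 + T\<^sup>2) * \<sigma>\<^sup>2"
        by (simp add: power_mult_distrib algebra_simps)
      ultimately have "\<bar>(t + \<sigma> * x)\<^sup>2 - \<alpha> * \<sigma>\<^sup>2\<bar> \<le> (2 + T\<^sup>2) * \<sigma>\<^sup>2"
        by linarith
      then show ?thesis using True by (simp add: w_def)
    qed (simp add: w_def)
    moreover have "\<bar>(1 - \<alpha>) * \<sigma>\<^sup>2\<bar> \<le> (3 + T\<^sup>2) * \<sigma>\<^sup>2"
      using \<alpha> by (auto simp: abs_mult intro!: mult_right_mono)
    \<comment> \<open>The 7 in \<open>b\<close> arises here:
      \<open>5 + 2 * T\<^sup>2 \<le> 7 * T\<^sup>2\<close> as \<open>T \<ge> 1\<close>.\<close>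
    moreover have "(3 + T\<^sup>2) * \<sigma>\<^sup>2 + (2 + T\<^sup>2) * \<sigma>\<^sup>2 \<le> b"
    proof -
      have "1 \<le> T\<^sup>2" using T by simp
      then have "(5 + 2 * T\<^sup>2) * \<sigma>\<^sup>2 \<le> (7 * T\<^sup>2) * \<sigma>\<^sup>2"
        by (intro mult_right_mono) auto
      then show ?thesis by (simp add: b_def T_def algebra_simps)
    qed
    ultimately show ?thesis
      unfolding B_def w_def[symmetric] by linarith
  qed
  note g = centered_square_moments[of t \<sigma>, folded g_def]
  note * = bounded_perturbation_moments[OF prob_space_std_normal g(1-3) B_meas B_le, folded eq]
  show "integrable std_normal (thresholded_error \<sigma> s d t)"
    "integrable std_normal (\<lambda>x. (thresholded_error \<sigma> s d t x)\<^sup>2)"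
    "\<bar>\<integral>x. thresholded_error \<sigma> s d t x \<partial>std_normal\<bar> \<le> b"
    "(\<integral>x. (thresholded_error \<sigma> s d t x)\<^sup>2 \<partial>std_normal) \<le> 8 * t\<^sup>2 * \<sigma>\<^sup>2 + 4 * \<sigma> ^ 4 + 2 * b\<^sup>2"
    using * g(4) by simp_all
qed

text \<open>Without signal, \<sigma> cancels from the cutoff condition, so the error is
  \<open>\<sigma>\<^sup>2\<close> times the centered variable of
  \<open>alpha_moments\<close>.\<close>

lemma thresholded_error_zero_moments:
  fixes \<sigma> :: real
  assumes sd: "1 \<le> s" "real s < sqrt (real d)" and \<sigma>: "0 < \<sigma>"
  shows "(\<integral>x. thresholded_error \<sigma> s d 0 x \<partial>std_normal) = 0"
    "real d * (\<integral>x. (thresholded_error \<sigma> s d 0 x)\<^sup>2 \<partial>std_normal)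
      \<le> 14 * \<sigma> ^ 4 * (real s)\<^sup>2 * threshold s d ^ 4"
proof -
  let ?h = "\<lambda>x. (x\<^sup>2 - alpha s d) * indicator {x. threshold s d < \<bar>x\<bar>} x"
  have eq: "thresholded_error \<sigma> s d 0 x = \<sigma>\<^sup>2 * ?h x" for x
    using \<sigma> by (simp add: thresholded_error_def abs_mult power_mult_distrib algebra_simps indicator_def)
  show "(\<integral>x. thresholded_error \<sigma> s d 0 x \<partial>std_normal) = 0"
    unfolding eq using alpha_moments(3)[OF sd] by simp
  have "real d * (\<integral>x. (thresholded_error \<sigma> s d 0 x)\<^sup>2 \<partial>std_normal)
      = \<sigma> ^ 4 * (real d * (\<integral>x. (?h x)\<^sup>2 \<partial>std_normal))"
    unfolding eq power_mult_distrib[of "\<sigma>\<^sup>2"] by simp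
  also have "\<dots> \<le> \<sigma> ^ 4 * (14 * (real s)\<^sup>2 * threshold s d ^ 4)"
    by (rule mult_left_mono[OF alpha_moments(4)[OF sd]]) simp
  finally show "real d * (\<integral>x. (thresholded_error \<sigma> s d 0 x)\<^sup>2 \<partial>std_normal)
      \<le> 14 * \<sigma> ^ 4 * (real s)\<^sup>2 * threshold s d ^ 4"
    by (simp add: ac_simps)
qed

section \<open>Risk in the sparse and the dense regime\<close>

text \<open>Only the support \<open>S\<close> contributes bias, at most \<open>s * b\<close> in
  total. The second moments split into a signal part, a part of size \<open>b\<^sup>2\<close> on
  \<open>S\<close>, and the null part \<open>v 0\<close>. The constant is
  \<open>668 = 8 + 4 * (49 + 102 + 14)\<close>.\<close>

lemma sparse_risk_le:
  fixes \<sigma> \<kappa> :: real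
  assumes sd: "1 \<le> s" "real s < sqrt (real d)" and \<sigma>: "0 < \<sigma>"
    and \<theta>: "Q d \<theta> \<le> \<kappa>\<^sup>2" "norm0 d \<theta> \<le> s"
  shows "(\<integral>\<^sup>+x. ennreal ((\<Sum>j=1..d. thresholded_error \<sigma> s d (\<theta> j) (x j))\<^sup>2) \<partial>PiM {1..d} (\<lambda>_. std_normal))
    \<le> ennreal (668 * psi \<sigma> s d \<kappa>)"
proof -
  define T b where "T = threshold s d" and "b = 7 * \<sigma>\<^sup>2 * T\<^sup>2"
  define S where "S = {j \<in> {1..d}. \<theta> j \<noteq> 0}"
  define m v where "m t = (\<integral>x. thresholded_error \<sigma> s d t x \<partial>std_normal)"
    and "v t = (\<integral>x. (thresholded_error \<sigma> s d t x)\<^sup>2 \<partial>std_normal)" for t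
  have T: "1 \<le> T" using threshold_ge_1[OF sd] by (simp add: T_def)
  note mom = thresholded_error_moments[OF sd \<sigma>, folded T_def, folded b_def m_def v_def]
  note mom0 = thresholded_error_zero_moments[OF sd \<sigma>, folded T_def m_def v_def]
  have S: "finite S" "S \<subseteq> {1..d}" "real (card S) \<le> real s"
    using \<theta>(2) by (auto simp: S_def norm0_def)
  have b: "0 \<le> b" by (simp add: b_def)
  have "\<bar>\<Sum>j=1..d. m (\<theta> j)\<bar> = \<bar>\<Sum>j\<in>S. m (\<theta> j)\<bar>"
    by (intro arg_cong[where f = abs] sum.mono_neutral_right) (auto simp: S_def mom0)
  also have "\<dots> \<le> (\<Sum>j\<in>S. b)"
    by (rule order_trans[OF sum_abs sum_mono]) (rule mom)
  also have "\<dots> \<le> real s * b" using S b by (simp add: mult_right_mono)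
  finally have "(\<Sum>j=1..d. m (\<theta> j))\<^sup>2 \<le> (real s * b)\<^sup>2"
    by (metis abs_ge_zero power2_abs power_mono)
  then have bias: "(\<Sum>j=1..d. m (\<theta> j))\<^sup>2 \<le> 49 * (\<sigma> ^ 4 * (real s)\<^sup>2 * T ^ 4)"
    by (simp add: b_def power_mult_distrib ac_simps flip: power_mult)
  have v0: "0 \<le> v t" for t by (simp add: v_def)
  \<comment> \<open>Off \<open>S\<close> the bound reduces to \<open>v 0\<close>; on
    \<open>S\<close> the extra \<open>v 0\<close> is harmless and allows a plain sum over all
    coordinates.\<close>
  have "v (\<theta> j) \<le> 8 * \<sigma>\<^sup>2 * (\<theta> j)\<^sup>2 + (if j \<in> S then 4 * \<sigma> ^ 4 + 2 * b\<^sup>2 else 0) + v 0"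
    if "j \<in> {1..d}" for j
    using mom(4)[of "\<theta> j"] v0[of 0] that by (auto simp: S_def ac_simps)
  then have "(\<Sum>j=1..d. v (\<theta> j))
      \<le> (\<Sum>j=1..d. 8 * \<sigma>\<^sup>2 * (\<theta> j)\<^sup>2 + (if j \<in> S then 4 * \<sigma> ^ 4 + 2 * b\<^sup>2 else 0) + v 0)"
    by (intro sum_mono)
  also have "\<dots> = 8 * \<sigma>\<^sup>2 * Q d \<theta> + real (card S) * (4 * \<sigma> ^ 4 + 2 * b\<^sup>2) + real d * v 0"
    using S by (simp add: sum.distrib Q_def sum_distrib_left Int_absorb1 flip: sum.inter_restrict)
  also have "\<dots> \<le> 8 * \<sigma>\<^sup>2 * \<kappa>\<^sup>2 + (real s)\<^sup>2 * (102 * \<sigma> ^ 4 * T ^ 4)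
      + 14 * \<sigma> ^ 4 * (real s)\<^sup>2 * T ^ 4"
  proof (intro add_mono mult_mono[of "real (card S)"])
    show "8 * \<sigma>\<^sup>2 * Q d \<theta> \<le> 8 * \<sigma>\<^sup>2 * \<kappa>\<^sup>2"
      using \<theta>(1) by (intro mult_left_mono) auto
    \<comment> \<open>The second moments on the support grow only linearly in \<open>s\<close>;
      rounding up to \<open>s\<^sup>2\<close> matches the order of the squared bias.\<close>
    show "real (card S) \<le> (real s)\<^sup>2"
      using S(3) sd(1) self_le_power[of "real s" 2] by simp
    have "4 * \<sigma> ^ 4 * 1 \<le> 4 * \<sigma> ^ 4 * T ^ 4"
      using T by (intro mult_left_mono) (auto simp: one_le_power)
    then show "4 * \<sigma> ^ 4 + 2 * b\<^sup>2 \<le> 102 * \<sigma> ^ 4 * T ^ 4"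
      by (simp add: b_def power_mult_distrib mult.commute flip: power_mult)
  qed (use mom0 in auto)
  finally have "(\<Sum>j=1..d. v (\<theta> j)) + (\<Sum>j=1..d. m (\<theta> j))\<^sup>2
      \<le> 8 * (\<sigma>\<^sup>2 * \<kappa>\<^sup>2) + 165 * (\<sigma> ^ 4 * (real s)\<^sup>2 * T ^ 4)"
    using bias by (simp add: ac_simps)
  also have "\<sigma> ^ 4 * (real s)\<^sup>2 * T ^ 4 = 4 * psi_bar \<sigma> s d"
  proof -
    have "T ^ 4 = (T\<^sup>2)\<^sup>2" by simp
    also have "T\<^sup>2 = 2 * ln (1 + real d / (real s)\<^sup>2)"
      by (simp add: T_def threshold_def)
    finally have "T ^ 4 = 4 * (ln (1 + real d / (real s)\<^sup>2))\<^sup>2"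
      by (simp add: power_mult_distrib)
    then show ?thesis using sd by (simp add: psi_bar_def)
  qed
  also have "8 * (\<sigma>\<^sup>2 * \<kappa>\<^sup>2) + 165 * (4 * psi_bar \<sigma> s d) \<le> 668 * psi \<sigma> s d \<kappa>"
    by (simp add: psi_def)
  finally have *: "(\<Sum>j=1..d. v (\<theta> j)) + (\<Sum>j=1..d. m (\<theta> j))\<^sup>2 \<le> 668 * psi \<sigma> s d \<kappa>" .
  have "(\<integral>\<^sup>+x. ennreal ((\<Sum>j=1..d. thresholded_error \<sigma> s d (\<theta> j) (x j))\<^sup>2) \<partial>PiM {1..d} (\<lambda>_. std_normal))
      \<le> ennreal ((\<Sum>j=1..d. v (\<theta> j)) + (\<Sum>j=1..d. m (\<theta> j))\<^sup>2)"
    unfolding v_def m_def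
    by (rule sum_square_le_product_measure) (use mom in \<open>auto intro: prob_space_std_normal\<close>)
  also have "\<dots> \<le> ennreal (668 * psi \<sigma> s d \<kappa>)"
    using * by (rule ennreal_leI)
  finally show ?thesis .
qed

text \<open>Each summand is centered, so only variances remain, and they add up to at most
  \<open>6 * psi \<sigma> s d \<kappa>\<close>. As \<open>psi\<close> is nonnegative, the constant
  of the sparse regime serves here too.\<close>

lemma dense_risk_le:
  fixes \<sigma> \<kappa> :: real
  assumes sd: "sqrt (real d) \<le> real s" and \<theta>: "Q d \<theta> \<le> \<kappa>\<^sup>2"
  shows "(\<integral>\<^sup>+x. ennreal ((\<Sum>j=1..d. 2 * \<theta> j * \<sigma> * x j + \<sigma>\<^sup>2 * ((x j)\<^sup>2 - 1))\<^sup>2) \<partial>PiM {1..d} (\<lambda>_. std_normal))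
    \<le> ennreal (668 * psi \<sigma> s d \<kappa>)"
proof -
  note g = centered_square_moments
  have "(\<integral>\<^sup>+x. ennreal ((\<Sum>j=1..d. 2 * \<theta> j * \<sigma> * x j + \<sigma>\<^sup>2 * ((x j)\<^sup>2 - 1))\<^sup>2) \<partial>PiM {1..d} (\<lambda>_. std_normal))
      \<le> ennreal ((\<Sum>j=1..d. 4 * (\<theta> j)\<^sup>2 * \<sigma>\<^sup>2 + 2 * \<sigma> ^ 4) + (\<Sum>j=1..d. 0)\<^sup>2)"
    using sum_square_le_product_measure[of "\<lambda>_. std_normal" "{1..d}"
        "\<lambda>j x. 2 * \<theta> j * \<sigma> * x + \<sigma>\<^sup>2 * (x\<^sup>2 - 1)"]
    by (simp only: g prob_space_std_normal finite_atLeastAtMost)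
  also have "\<dots> \<le> ennreal (668 * psi \<sigma> s d \<kappa>)"
  proof (rule ennreal_leI)
    have "(\<Sum>j=1..d. 4 * (\<theta> j)\<^sup>2 * \<sigma>\<^sup>2 + 2 * \<sigma> ^ 4) + (\<Sum>j=1..d. 0)\<^sup>2
        = 4 * (\<sigma>\<^sup>2 * Q d \<theta>) + 2 * (\<sigma> ^ 4 * real d)"
      by (simp add: sum.distrib Q_def sum_distrib_left ac_simps)
    moreover have "\<sigma>\<^sup>2 * Q d \<theta> \<le> \<sigma>\<^sup>2 * \<kappa>\<^sup>2" using \<theta> by (simp add: mult_left_mono)
    moreover have "0 \<le> \<sigma>\<^sup>2 * \<kappa>\<^sup>2" by simp
    moreover have "\<sigma>\<^sup>2 * \<kappa>\<^sup>2 \<le> psi \<sigma> s d \<kappa>" "\<sigma> ^ 4 * real d \<le> psi \<sigma> s d \<kappa>"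
      using sd by (auto simp: psi_def psi_bar_def)
    ultimately show "(\<Sum>j=1..d. 4 * (\<theta> j)\<^sup>2 * \<sigma>\<^sup>2 + 2 * \<sigma> ^ 4) + (\<Sum>j=1..d. 0)\<^sup>2
        \<le> 668 * psi \<sigma> s d \<kappa>" by linarith
  qed
  finally show ?thesis .
qed

section \<open>Risk bound for every parameter\<close>

text \<open>If \<open>\<kappa> ^ 4 < psi \<sigma> s d \<kappa>\<close>, the estimator is 0 and its
  squared error is \<open>(Q d \<theta>)\<^sup>2 \<le> \<kappa> ^ 4 = psi_Q \<sigma> s d
  \<kappa>\<close>. Otherwise \<open>psi_Q\<close> equals \<open>psi\<close>, and after passing to
  the noise variables the two regimes apply.\<close>

lemma risk_le:
  fixes \<sigma> \<kappa> :: real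
  assumes s: "1 \<le> s" and \<sigma>: "0 < \<sigma>" and \<kappa>: "0 < \<kappa>" and \<theta>: "\<theta> \<in> B2 d \<kappa> \<inter> B0 d s"
  shows "(\<integral>\<^sup>+y. ennreal ((Q_hat \<sigma> s d \<kappa> y - Q d \<theta>)\<^sup>2) \<partial>obs_law d \<sigma> \<theta>)
    \<le> ennreal (668 * psi_Q \<sigma> s d \<kappa>)"
proof -
  let ?M = "PiM {1..d} (\<lambda>_. std_normal)"
  let ?y = "\<lambda>x. \<lambda>j\<in>{1..d}. \<theta> j + \<sigma> * x j"
  have Q0: "0 \<le> Q d \<theta>" by (simp add: Q_def sum_nonneg)
  have Q: "Q d \<theta> \<le> \<kappa>\<^sup>2"
    using \<theta> \<kappa> by (auto simp: B2_def norm2_def intro: sqrt_le_D)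
  have n0: "norm0 d \<theta> \<le> s" using \<theta> by (simp add: B0_def)
  show ?thesis
  proof (cases "\<kappa> ^ 4 < psi \<sigma> s d \<kappa>")
    case True
    have "(Q d \<theta>)\<^sup>2 \<le> (\<kappa>\<^sup>2)\<^sup>2" using Q Q0 by (rule power_mono)
    also have "\<dots> \<le> 668 * psi_Q \<sigma> s d \<kappa>" using True by (simp add: psi_Q_def)
    finally show ?thesis
      using True prob_space.emeasure_space_1[OF prob_space_obs_law, of d \<sigma> \<theta>]
      by (simp add: Q_hat_def ennreal_leI)
  next
    case False
    have [measurable]: "?y \<in> ?M \<rightarrow>\<^sub>M PiM {1..d} (\<lambda>_. borel)" by measurable
    have [measurable]: "Q_hat \<sigma> s d \<kappa> \<in> borel_measurable (PiM {1..d} (\<lambda>_. borel))"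
      using measurable_Q_hat[of \<sigma> s d \<kappa> \<theta>] by (simp add: obs_law_def)
    have law: "(\<integral>\<^sup>+y. ennreal ((Q_hat \<sigma> s d \<kappa> y - Q d \<theta>)\<^sup>2) \<partial>obs_law d \<sigma> \<theta>)
        = (\<integral>\<^sup>+x. ennreal ((Q_hat \<sigma> s d \<kappa> (?y x) - Q d \<theta>)\<^sup>2) \<partial>?M)"
      unfolding obs_law_def by (rule nn_integral_distr) measurable
    have psi: "psi_Q \<sigma> s d \<kappa> = psi \<sigma> s d \<kappa>" using False by (simp add: psi_Q_def)
    show ?thesis
    proof (cases "real s < sqrt (real d)")
      case True
      have "Q_hat \<sigma> s d \<kappa> (?y x) - Q d \<theta> = (\<Sum>j=1..d. thresholded_error \<sigma> s d (\<theta> j) (x j))" for x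
        using False True
        by (simp add: Q_hat_def Q_def thresholded_error_def threshold_def sum_subtractf)
      then show ?thesis
        using sparse_risk_le[OF s True \<sigma> Q n0] by (simp add: law psi)
    next
      case dense: False
      have "Q_hat \<sigma> s d \<kappa> (?y x) - Q d \<theta>
          = (\<Sum>j=1..d. (\<theta> j + \<sigma> * x j)\<^sup>2 - \<sigma>\<^sup>2 - (\<theta> j)\<^sup>2)" for x
        using False dense by (simp add: Q_hat_def Q_def sum_subtractf)
      moreover have "(\<theta> j + \<sigma> * x j)\<^sup>2 - \<sigma>\<^sup>2 - (\<theta> j)\<^sup>2
          = 2 * \<theta> j * \<sigma> * x j + \<sigma>\<^sup>2 * ((x j)\<^sup>2 - 1)" for x j
        by (simp add: power2_eq_square algebra_simps)
      ultimately show ?thesis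
        using dense_risk_le dense Q by (simp add: law psi)
    qed
  qed
qed

theorem theorem5:
  shows "\<exists>C::real. C > 0 \<and>
    (\<forall>(s::nat) (d::nat) (\<kappa>::real) (\<sigma>::real).
       1 \<le> s \<and> s \<le> d \<and> \<kappa> > 0 \<and> \<sigma> > 0 \<longrightarrow>
       (SUP \<theta> \<in> B2 d \<kappa> \<inter> B0 d s.
          \<integral>\<^sup>+ y. ennreal ((Q_hat \<sigma> s d \<kappa> y - Q d \<theta>)\<^sup>2) \<partial>(obs_law d \<sigma> \<theta>))
       \<le> ennreal (C * psi_Q \<sigma> s d \<kappa>))"
  by (rule exI[of _ 668]) (auto intro!: SUP_least risk_le)

end
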